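(* Let $\sigma_1>0$ and let $r$ satisfy $0<r\le r_c$, where $r_c=\tfrac43$. Consider the autonomous system on $\mathbb{R}^3$ with coordinates $(x,p,y)$ $$\dot x=(x+y)^2-1+\sigma_1^2p,\qquad \dot p=-2(x+y)p,\qquad \dot y=ry(3-y),$$ and its equilibria $s_1=(-1,0,0)$ and $s_2=(-2,0,3)$. Then there exists a heteroclinic connection from $s_1$ to $s_2$ that goes through the plane $\{y=-x\}$ at $y=\tfrac32$; that is, there exists a solution $(x(t),p(t),y(t))$ of the system, defined for all $t\in\mathbb{R}$, such that $(x(t),p(t),y(t))\to s_1$ as $t\to-\infty$, $(x(t),p(t),y(t))\to s_2$ as $t\to+\infty$, and $x(t_0)=-\tfrac32$, $y(t_0)=\tfrac32$ for some $t_0\in\mathbb{R}$.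
   Context: The dot denotes $d/dt$, and points are written in the order $(x,p,y)$. The constant $r_c=4/3$ is the critical rate of the planar system $\dot x=(x+y)^2-1$, $\dot y=ry(3-y)$ (the restriction of the three-dimensional system to the invariant plane $p=0$): it is the value of $r$ at which that planar system has a heteroclinic connection from $(-1,0)$ to $(-2,3)$, namely along the line $x=-\tfrac{y}{3}-1$. *)

theory Defs
  imports "HOL-Analysis.Analysis"
begin

definition is_equilibrium :: "('a::real_normed_vector \<Rightarrow> 'a) \<Rightarrow> 'a \<Rightarrow> bool"
  where "is_equilibrium F s \<longleftrightarrow> F s = 0"

definition is_global_solution :: "('a::real_normed_vector \<Rightarrow> 'a) \<Rightarrow> (real \<Rightarrow> 'a) \<Rightarrow> bool"
  where "is_global_solution F u \<longleftrightarrow> (\<forall>t. (u has_vector_derivative F (u t)) (at t))"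

definition heteroclinic_connection ::
    "('a::real_normed_vector \<Rightarrow> 'a) \<Rightarrow> 'a \<Rightarrow> 'a \<Rightarrow> (real \<Rightarrow> 'a) \<Rightarrow> bool"
  where "heteroclinic_connection F a b u \<longleftrightarrow>
    is_equilibrium F a \<and> is_equilibrium F b \<and> is_global_solution F u \<and>
    (u \<longlongrightarrow> a) at_bot \<and> (u \<longlongrightarrow> b) at_top"

text \<open>Points of the phase space are triples in the order \<open>(x, p, y)\<close>.\<close>

definition vfield :: "real \<Rightarrow> real \<Rightarrow> real \<times> real \<times> real \<Rightarrow> real \<times> real \<times> real"
  where "vfield \<sigma>\<^sub>1 r = (\<lambda>(x, p, y).
    ((x + y)\<^sup>2 - 1 + \<sigma>\<^sub>1\<^sup>2 * p,
     - 2 * (x + y) * p,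
     r * y * (3 - y)))"

text \<open>The critical rate: for \<open>r = 4/3\<close> the line \<open>x = - y/3 - 1\<close> in the plane \<open>p = 0\<close> is
  invariant and carries a connection from \<open>(-1, 0)\<close> to \<open>(-2, 3)\<close> in the coordinates
  \<open>(x, y)\<close>.\<close>

definition r_c :: real
  where "r_c = 4 / 3"

definition s\<^sub>1 :: "real \<times> real \<times> real"
  where "s\<^sub>1 = (-1, 0, 0)"

definition s\<^sub>2 :: "real \<times> real \<times> real"
  where "s\<^sub>2 = (-2, 0, 3)"

end

theory Submission
  imports Defs
begin

text \<open>
  Put \<open>u = x + y\<close> and \<open>Q = \<sigma>\<^sup>2 p\<close>. The equation for \<open>y\<close> decouples; the solution through
  \<open>y = 3/2\<close> is \<open>y(t) = 3/2 (1 + tanh (3rt/2))\<close>, and with \<open>g(t) = dy/dt\<close> the rest of the system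
  is \<open>u' = u\<^sup>2 - 1 + Q + g(t)\<close>, \<open>Q' = -2uQ\<close>. The function \<open>g\<close> is even, so the system is
  reversible under \<open>(t, u, Q) \<mapsto> (-t, -u, Q)\<close>: a solution on \<open>t \<ge> 0\<close> that starts at \<open>u = 0\<close> and
  tends to \<open>(u, Q) = (1, 0)\<close> extends, with \<open>u\<close> odd and \<open>Q\<close> even, to a solution on the whole
  line that tends to \<open>(-1, 0)\<close> in the past. That is the required connection, and it crosses
  \<open>y = -x\<close> at time \<open>0\<close>, where \<open>y = 3/2\<close>. So the only unknown is the starting value
  \<open>q = Q(0)\<close>, and it is found by shooting.

  Three facts make the shooting work. If \<open>u\<close> stays in \<open>[0, 1]\<close> for all \<open>t \<ge> 0\<close>, the orbit has the
  required limit (\<open>trapped_limits\<close>): \<open>Q\<close> decreases and \<open>u\<close> is eventually monotone, because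
  \<open>u'\<close> times a positive function is decreasing; hence both converge, to values with
  \<open>u\<^sup>2 + Q = 1\<close>, and \<open>u = 0\<close>, \<open>Q = 1\<close> is impossible since \<open>u\<close> would then be increasing.
  Next, an orbit that leaves \<open>[0, 1]\<close> does so on one side only, for good and stably in \<open>q\<close>
  (\<open>exits_exclusive\<close>): above \<open>1\<close> the right-hand side is positive, and once \<open>u\<close> has turned
  negative the term \<open>-1 + Q + g\<close> is negative and keeps decreasing. Thus the values of \<open>q\<close> that
  exit above and those that exit below form two disjoint open sets. Finally, \<open>q = 12\<close> exits above
  (\<open>large_amplitude_exits_above\<close>), while \<open>q = 0\<close> does not
  (\<open>zero_amplitude_below_1\<close>). This last point is where \<open>r \<le> 4/3\<close> enters: exactly then
  \<open>tanh (3rt/2)\<close> is a supersolution of \<open>u' = u\<^sup>2 - 1 + g\<close>, and at \<open>r = 4/3\<close> it is the solution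
  itself. As the line is connected, the two sets cannot cover it (if \<open>q = 0\<close> lies in neither,
  nothing is left to prove), and some \<open>q\<close> yields a trapped orbit (\<open>trapped_orbit_exists\<close>).

  Global existence and continuous dependence on \<open>q\<close> come from a Picard--Lindelof theorem and a
  Gronwall estimate for globally Lipschitz fields. To apply them, \<open>u\<close> is clamped to \<open>[0, 1]\<close> on the
  right-hand side and \<open>Q\<close> is written as \<open>q exp (-2w)\<close> with \<open>w' = u\<close>, which keeps it nonnegative
  and bounded; on a trapped orbit the clamping changes nothing.
\<close>

section \<open>Initial value problems on a half-line\<close>

lemma has_integral_exp_mult:
  fixes K :: real
  assumes "K \<noteq> 0" "0 \<le> b"
  shows "((\<lambda>s. exp (K * s)) has_integral (exp (K * b) - 1) / K) {0..b}"
proof -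
  have "((\<lambda>s. exp (K * s)) has_integral (exp (K * b) / K - exp (K * 0) / K)) {0..b}"
    using assms
    by (intro fundamental_theorem_of_calculus)
       (auto intro!: derivative_eq_intros simp flip: has_real_derivative_iff_has_vector_derivative)
  then show ?thesis by (simp add: diff_divide_distrib)
qed

lemma has_vector_derivative_integral_halfline:
  fixes h :: "real \<Rightarrow> 'a::banach"
  assumes "continuous_on UNIV h" "0 \<le> t"
  shows "((\<lambda>u. integral {0..u} h) has_vector_derivative h t) (at t within {0..})"
proof -
  have "((\<lambda>u. integral {0..u} h) has_vector_derivative h t) (at t within {0..t+1})"
    using assms by (intro integral_has_vector_derivative continuous_on_subset[OF assms(1)]) auto
  moreover have "at t within {0..t+1} = at t within {0..}"
    by (rule at_within_nhd[of _ "{..<t+1}"]) auto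
  ultimately show ?thesis by simp
qed

text \<open>
  The fixed point is sought for \<open>z(t) = exp (-Kt) x(t)\<close> with \<open>K \<ge> 2L\<close>: in this weighted norm
  the integral operator is a contraction with factor \<open>1/2\<close> on the whole half-line at once, so no
  local solutions have to be glued together. Boundedness of \<open>f\<close> makes the operator map bounded
  functions to bounded functions. To use the complete space of bounded continuous functions on the
  full real line, functions are frozen at their value at \<open>0\<close> for negative times.
\<close>
theorem picard_lindelof_halfline:
  fixes f :: "real \<Rightarrow> 'a::banach \<Rightarrow> 'a"
  assumes cont: "continuous_on UNIV (\<lambda>(t, x). f t x)"
    and lip: "\<And>t x y. norm (f t x - f t y) \<le> L * norm (x - y)"
    and bound: "\<And>t x. norm (f t x) \<le> M"
  shows "\<exists>x. x 0 = x0 \<and> (\<forall>t\<ge>0. (x has_vector_derivative f t (x t)) (at t within {0..}))"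
proof -
  have M: "M \<ge> 0" using bound[of 0 0] norm_ge_zero order_trans by blast
  \<comment> \<open>The maximum makes \<open>K\<close> positive even if \<open>L\<close> is not.\<close>
  define K where "K = 2 * max 1 L"
  have K: "K > 0" "2 * L \<le> K" by (auto simp: K_def)
  define h where "h = (\<lambda>(z::real \<Rightarrow>\<^sub>C 'a) s. f s (exp (K * s) *\<^sub>R z s))"
  have h_cont: "continuous_on UNIV (h z)" for z
  proof -
    have "continuous_on UNIV ((\<lambda>(t, x). f t x) \<circ> (\<lambda>s. (s, exp (K * s) *\<^sub>R z s)))"
      by (intro continuous_on_compose continuous_intros continuous_on_subset[OF cont]) auto
    then show ?thesis by (simp add: h_def o_def)
  qed
  have h_int: "h z integrable_on {0..b}" for z b
    by (intro integrable_continuous_real continuous_on_subset[OF h_cont]) auto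
  define P where "P = (\<lambda>z t. exp (- K * max 0 t) *\<^sub>R (x0 + integral {0..max 0 t} (h z)))"
  have P_bcontfun: "P z \<in> bcontfun" for z
  proof (rule bcontfun_normI)
    have "continuous_on {0..} (\<lambda>t. integral {0..t} (h z))"
      using has_vector_derivative_integral_halfline[OF h_cont]
      by (auto simp: continuous_on_eq_continuous_within intro!: has_vector_derivative_continuous)
    then have "continuous_on UNIV ((\<lambda>t. integral {0..t} (h z)) \<circ> (\<lambda>t. max 0 t))"
      by (intro continuous_on_compose continuous_intros) (auto elim: continuous_on_subset)
    then show "continuous_on UNIV (P z)"
      unfolding P_def o_def by (intro continuous_intros)
    show "norm (P z t) \<le> norm x0 + M / K" for t
    proof -
      define \<tau> where "\<tau> = max 0 t"
      have \<tau>: "\<tau> \<ge> 0" by (simp add: \<tau>_def)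
      have "norm (integral {0..\<tau>} (h z)) \<le> integral {0..\<tau>} (\<lambda>_. M)"
        by (intro integral_norm_bound_integral h_int) (auto simp: h_def bound)
      then have "norm (x0 + integral {0..\<tau>} (h z)) \<le> norm x0 + M * \<tau>"
        using \<tau> by (intro norm_triangle_le) (simp add: mult.commute)
      then have "norm (P z t) \<le> exp (- K * \<tau>) * (norm x0 + M * \<tau>)"
        by (simp add: P_def flip: \<tau>_def)
      also have "\<dots> = exp (- K * \<tau>) * norm x0 + M / K * (exp (- K * \<tau>) * (K * \<tau>))"
        using K by (simp add: field_simps)
      also have "\<dots> \<le> 1 * norm x0 + M / K * 1"
      proof (intro add_mono mult_mono)
        have "K * \<tau> \<le> exp (K * \<tau>)" using exp_ge_add_one_self[of "K * \<tau>"] by linarith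
        then show "exp (- K * \<tau>) * (K * \<tau>) \<le> 1" by (simp add: exp_minus field_simps)
      qed (use K \<tau> M in auto)
      finally show ?thesis by simp
    qed
  qed
  define \<Phi> where "\<Phi> = (\<lambda>z. Bcontfun (P z))"
  have \<Phi>: "apply_bcontfun (\<Phi> z) = P z" for z
    using P_bcontfun by (simp add: \<Phi>_def Bcontfun_inverse)
  have "dist (\<Phi> z) (\<Phi> w) \<le> 1/2 * dist z w" for z w
  proof (rule dist_bound)
    fix t :: real
    define \<tau> where "\<tau> = max 0 t"
    have \<tau>: "\<tau> \<ge> 0" by (simp add: \<tau>_def)
    define d where "d = dist z w"
    have d: "d \<ge> 0" by (simp add: d_def)
    have diff: "norm (h z s - h w s) \<le> (K/2 * d) * exp (K * s)" for s
    proof -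
      have "norm (h z s - h w s) \<le> L * norm (exp (K * s) *\<^sub>R z s - exp (K * s) *\<^sub>R w s)"
        unfolding h_def by (rule lip)
      also have "\<dots> = L * (exp (K * s) * dist (z s) (w s))"
        by (simp add: dist_norm flip: scaleR_diff_right)
      also have "\<dots> \<le> K/2 * (exp (K * s) * d)"
        using K by (intro mult_mono) (auto simp: d_def dist_bounded)
      finally show ?thesis by (simp add: mult_ac)
    qed
    have "norm (integral {0..\<tau>} (\<lambda>s. h z s - h w s))
        \<le> integral {0..\<tau>} (\<lambda>s. (K/2 * d) * exp (K * s))"
      by (intro integral_norm_bound_integral diff integrable_diff h_int
            integrable_continuous_real continuous_intros)
    also have "\<dots> = (K/2 * d) * ((exp (K * \<tau>) - 1) / K)"
      using has_integral_exp_mult[of K \<tau>] K \<tau>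
      by (intro integral_unique has_integral_mult_right) auto
    also have "\<dots> \<le> 1/2 * d * exp (K * \<tau>)" using K d by (simp add: field_simps)
    finally have *: "norm (integral {0..\<tau>} (h z) - integral {0..\<tau>} (h w)) \<le> 1/2 * d * exp (K * \<tau>)"
      by (simp add: integral_diff h_int)
    have "dist (\<Phi> z t) (\<Phi> w t) = exp (- K * \<tau>) * norm (integral {0..\<tau>} (h z) - integral {0..\<tau>} (h w))"
      by (simp add: \<Phi> P_def dist_norm flip: \<tau>_def scaleR_diff_right)
    also have "\<dots> \<le> exp (- K * \<tau>) * (1/2 * d * exp (K * \<tau>))"
      by (intro mult_left_mono *) auto
    also have "\<dots> = 1/2 * d" by (simp add: exp_minus field_simps)
    finally show "dist (\<Phi> z t) (\<Phi> w t) \<le> 1/2 * dist z w" by (simp add: d_def)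
  qed
  then obtain z where z: "\<Phi> z = z"
    using banach_fix_type[of "1/2" \<Phi>] by auto
  define x where "x = (\<lambda>t. x0 + integral {0..t} (h z))"
  have x_z: "x t = exp (K * t) *\<^sub>R z t" if "t \<ge> 0" for t
  proof -
    have "z t = exp (- K * t) *\<^sub>R x t"
      using fun_cong[OF \<Phi>[of z], of t] that unfolding z by (simp add: P_def x_def)
    then have "exp (K * t) *\<^sub>R z t = (exp (K * t) * exp (- K * t)) *\<^sub>R x t"
      by simp
    then show ?thesis by (simp add: exp_minus)
  qed
  show ?thesis
  proof (intro exI[of _ x] conjI allI impI)
    show "x 0 = x0" by (simp add: x_def)
    fix t :: real assume t: "t \<ge> 0"
    have "(x has_vector_derivative h z t) (at t within {0..})"
      unfolding x_def
      using has_vector_derivative_add[OF has_vector_derivative_const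
          has_vector_derivative_integral_halfline[OF h_cont t]] by simp
    then show "(x has_vector_derivative f t (x t)) (at t within {0..})"
      unfolding h_def x_z[OF t, symmetric] .
  qed
qed

lemma at_within_halfline_interior:
  fixes t :: real
  assumes "t > 0"
  shows "at t within {0..} = at t"
  using assms by (intro at_within_interior) simp

text \<open>
  The squared distance \<open>D\<close> of two solutions satisfies \<open>D' \<le> 2LD\<close> by the Cauchy--Schwarz
  inequality, so \<open>exp (-2Lt) D\<close> is nonincreasing.
\<close>
lemma gronwall_dist:
  fixes f :: "real \<Rightarrow> 'a::real_inner \<Rightarrow> 'a"
  assumes lip: "\<And>t x y. norm (f t x - f t y) \<le> L * norm (x - y)"
    and x: "\<And>t. t \<ge> 0 \<Longrightarrow> (x has_vector_derivative f t (x t)) (at t within {0..})"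
    and y: "\<And>t. t \<ge> 0 \<Longrightarrow> (y has_vector_derivative f t (y t)) (at t within {0..})"
    and t: "t \<ge> 0"
  shows "norm (x t - y t) \<le> exp (L * t) * norm (x 0 - y 0)"
proof -
  define D where "D = (\<lambda>t. (x t - y t) \<bullet> (x t - y t))"
  have "D t * exp (- (2 * L * t)) \<le> D 0 * exp (- (2 * L * 0))"
  proof (rule DERIV_nonpos_imp_decreasing_open[OF t])
    have "continuous_on {0..} x" "continuous_on {0..} y"
      using x y by (auto simp: continuous_on_eq_continuous_within
          intro!: has_vector_derivative_continuous)
    then have "continuous_on {0..t} x" "continuous_on {0..t} y"
      by (auto elim: continuous_on_subset)
    then show "continuous_on {0..t} (\<lambda>t. D t * exp (- (2 * L * t)))"
      unfolding D_def by (intro continuous_intros)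
    fix s assume "0 < s" "s < t"
    then have xs: "(x has_derivative (\<lambda>h. h *\<^sub>R f s (x s))) (at s)"
      and ys: "(y has_derivative (\<lambda>h. h *\<^sub>R f s (y s))) (at s)"
      using x[of s] y[of s] at_within_halfline_interior[of s]
      by (simp_all add: has_vector_derivative_def)
    define a where "a = (x s - y s) \<bullet> (f s (x s) - f s (y s))"
    have "(D has_real_derivative 2 * a) (at s)"
    proof -
      have "(D has_derivative (\<lambda>h. (x s - y s) \<bullet> (h *\<^sub>R f s (x s) - h *\<^sub>R f s (y s))
          + (h *\<^sub>R f s (x s) - h *\<^sub>R f s (y s)) \<bullet> (x s - y s))) (at s)"
        unfolding D_def by (intro has_derivative_inner has_derivative_diff xs ys)
      moreover have "(\<lambda>h. (x s - y s) \<bullet> (h *\<^sub>R f s (x s) - h *\<^sub>R f s (y s))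
          + (h *\<^sub>R f s (x s) - h *\<^sub>R f s (y s)) \<bullet> (x s - y s)) = (*) (2 * a)"
        by (simp add: fun_eq_iff a_def inner_commute flip: scaleR_diff_right)
      ultimately show ?thesis by (simp add: has_field_derivative_def)
    qed
    then have "((\<lambda>t. D t * exp (- (2 * L * t))) has_real_derivative
        2 * (a - L * D s) * exp (- (2 * L * s))) (at s)"
      by (auto intro!: derivative_eq_intros simp: algebra_simps)
    moreover have "a \<le> L * D s"
    proof -
      have "a \<le> norm (x s - y s) * norm (f s (x s) - f s (y s))"
        unfolding a_def by (rule norm_cauchy_schwarz)
      also have "\<dots> \<le> norm (x s - y s) * (L * norm (x s - y s))"
        by (intro mult_left_mono lip) auto
      also have "\<dots> = L * D s"
        unfolding D_def power2_norm_eq_inner[symmetric] by (simp add: power2_eq_square)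
      finally show ?thesis .
    qed
    ultimately show "\<exists>d. ((\<lambda>t. D t * exp (- (2 * L * t))) has_real_derivative d) (at s) \<and> d \<le> 0"
      by (intro exI[of _ "2 * (a - L * D s) * exp (- (2 * L * s))"])
         (auto intro!: mult_nonpos_nonneg)
  qed
  then have "D t \<le> exp (2 * L * t) * D 0"
    by (simp add: exp_minus field_simps)
  then have "(norm (x t - y t))\<^sup>2 \<le> (exp (L * t) * norm (x 0 - y 0))\<^sup>2"
    unfolding D_def power2_norm_eq_inner[symmetric] power_mult_distrib
    by (simp add: exp_double[symmetric] mult.assoc)
  then show ?thesis by (rule power2_le_imp_le) auto
qed

section \<open>Barriers and limits for functions of one real variable\<close>

text \<open>
  At the first time where \<open>f \<le> K\<close> the function would have been nondecreasing all the way from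
  \<open>a\<close>, contradicting \<open>f a > K\<close>. The sign of the derivative is prescribed only strictly above the
  level \<open>K\<close>, so nothing has to be known about the field at the barrier itself.
\<close>
lemma barrier_above:
  fixes f :: "real \<Rightarrow> real"
  assumes cont: "continuous_on {a..b} f" and ab: "a \<le> b" and "f a > K"
    and deriv: "\<And>s. a < s \<Longrightarrow> s < b \<Longrightarrow> f s > K \<Longrightarrow> \<exists>d. (f has_real_derivative d) (at s) \<and> d \<ge> 0"
  shows "f b > K"
proof (rule ccontr)
  assume "\<not> f b > K"
  define S where "S = {s \<in> {a..b}. f s \<le> K}"
  have "S \<noteq> {}" using \<open>\<not> f b > K\<close> ab by (auto simp: S_def)
  moreover have "closed S"
    unfolding S_def using cont by (intro continuous_on_closed_Collect_le continuous_intros) auto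
  moreover have bdd: "bdd_below S" by (auto simp: S_def bdd_below_def)
  ultimately have s: "Inf S \<in> S" by (simp add: closed_contains_Inf)
  have before: "f t > K" if "a \<le> t" "t < Inf S" for t
  proof -
    have "t \<notin> S" using that(2) bdd cInf_lower by (metis leD)
    then show ?thesis using that s by (auto simp: S_def)
  qed
  have "f a \<le> f (Inf S)"
  proof (rule DERIV_nonneg_imp_increasing_open[where f = f and a = a and b = "Inf S"])
    show "continuous_on {a..Inf S} f"
      using cont s by (auto simp: S_def elim: continuous_on_subset)
    show "\<exists>d. (f has_real_derivative d) (at t) \<and> d \<ge> 0" if "a < t" "t < Inf S" for t
      using that before[of t] s by (intro deriv) (auto simp: S_def)
  qed (use s in \<open>auto simp: S_def\<close>)
  then show False using \<open>f a > K\<close> s by (auto simp: S_def)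
qed

lemma barrier_above_backwards:
  fixes f :: "real \<Rightarrow> real"
  assumes cont: "continuous_on {a..b} f" and ab: "a \<le> b" and "f b > K"
    and deriv: "\<And>s. a < s \<Longrightarrow> s < b \<Longrightarrow> f s > K \<Longrightarrow> \<exists>d. (f has_real_derivative d) (at s) \<and> d \<le> 0"
  shows "f a > K"
proof -
  have "f (- (- a)) > K"
  proof (rule barrier_above[where f = "\<lambda>s. f (- s)" and a = "- b" and b = "- a"])
    have "continuous_on {-b..-a} (f \<circ> uminus)"
      by (intro continuous_on_compose continuous_intros) (auto simp: cont)
    then show "continuous_on {-b..-a} (\<lambda>s. f (- s))" by (simp add: o_def)
    fix s assume s: "- b < s" "s < - a" "f (- s) > K"
    then obtain d where d: "(f has_real_derivative d) (at (- s))" "d \<le> 0"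
      using deriv[of "- s"] by auto
    have "((\<lambda>s. f (- s)) has_real_derivative - d) (at s)"
      using d(1) DERIV_mirror[of f d s] by simp
    then show "\<exists>d. ((\<lambda>s. f (- s)) has_real_derivative d) (at s) \<and> d \<ge> 0"
      using d by (intro exI[of _ "- d"]) auto
  qed (use assms in auto)
  then show ?thesis by simp
qed

lemma mono_bounded_tendsto_at_top:
  fixes f :: "real \<Rightarrow> real"
  assumes mono: "\<And>s t. T \<le> s \<Longrightarrow> s \<le> t \<Longrightarrow> f s \<le> f t" and bound: "\<And>t. T \<le> t \<Longrightarrow> f t \<le> B"
  shows "\<exists>l. (f \<longlongrightarrow> l) at_top"
proof -
  define l where "l = Sup (f ` {T..})"
  have bdd: "bdd_above (f ` {T..})" using bound by (auto simp: bdd_above_def)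
  have "(f \<longlongrightarrow> l) at_top"
  proof (rule order_tendstoI)
    fix a assume "a < l"
    then obtain s where s: "s \<ge> T" "a < f s"
      unfolding l_def using less_cSup_iff[OF _ bdd] by auto
    show "eventually (\<lambda>t. a < f t) at_top"
      using eventually_ge_at_top[of s] by eventually_elim (use mono s in \<open>meson less_le_trans\<close>)
  next
    fix a assume a: "l < a"
    show "eventually (\<lambda>t. f t < a) at_top"
      using eventually_ge_at_top[of T]
    proof eventually_elim
      case (elim t)
      then have "f t \<le> l" unfolding l_def by (intro cSup_upper bdd) auto
      with a show ?case by simp
    qed
  qed
  then show ?thesis ..
qed

lemma antimono_bounded_tendsto_at_top:
  fixes f :: "real \<Rightarrow> real"
  assumes "\<And>s t. T \<le> s \<Longrightarrow> s \<le> t \<Longrightarrow> f t \<le> f s" and "\<And>t. T \<le> t \<Longrightarrow> B \<le> f t"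
  shows "\<exists>l. (f \<longlongrightarrow> l) at_top"
proof -
  obtain l where "((\<lambda>t. - f t) \<longlongrightarrow> l) at_top"
    using mono_bounded_tendsto_at_top[of T "\<lambda>t. - f t" "- B"] assms by auto
  then show ?thesis using tendsto_minus by fastforce
qed

text \<open>
  By the mean value theorem \<open>f (t + 1) - f t\<close> is a value of the derivative at a point beyond
  \<open>t\<close>, and this difference tends to \<open>l - l\<close>.
\<close>
lemma tendsto_deriv_limit_zero:
  fixes f f' :: "real \<Rightarrow> real"
  assumes deriv: "\<And>t. t > T \<Longrightarrow> (f has_real_derivative f' t) (at t)"
    and f: "(f \<longlongrightarrow> l) at_top" and f': "(f' \<longlongrightarrow> m) at_top"
  shows "m = 0"
proof -
  have "\<forall>t>T. \<exists>\<xi>>t. f (t + 1) - f t = f' \<xi>"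
  proof (intro allI impI)
    fix t assume t: "t > T"
    obtain \<xi> where "t < \<xi>" "f (t + 1) - f t = (t + 1 - t) * f' \<xi>"
      using MVT2[of t "t + 1" f f'] deriv t by auto
    then show "\<exists>\<xi>>t. f (t + 1) - f t = f' \<xi>" by auto
  qed
  then obtain \<xi> where \<xi>: "\<And>t. t > T \<Longrightarrow> \<xi> t > t" "\<And>t. t > T \<Longrightarrow> f (t + 1) - f t = f' (\<xi> t)"
    by metis
  have "filterlim \<xi> at_top at_top"
    by (rule filterlim_at_top_mono[OF filterlim_ident])
       (use eventually_gt_at_top[of T] in \<open>eventually_elim, use \<xi>(1) less_imp_le in blast\<close>)
  then have "((\<lambda>t. f' (\<xi> t)) \<longlongrightarrow> m) at_top"
    by (rule filterlim_compose[OF f'])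
  moreover have "((\<lambda>t. f' (\<xi> t)) \<longlongrightarrow> l - l) at_top"
  proof (rule Lim_transform_eventually)
    have "((\<lambda>t. f (t + 1)) \<longlongrightarrow> l) at_top"
      by (rule filterlim_compose[OF f])
         (auto intro: filterlim_tendsto_add_at_top filterlim_ident
            simp: add.commute[of _ 1])
    then show "((\<lambda>t. f (t + 1) - f t) \<longlongrightarrow> l - l) at_top"
      by (intro tendsto_intros f)
    show "\<forall>\<^sub>F t in at_top. f (t + 1) - f t = f' (\<xi> t)"
      using eventually_gt_at_top[of T] by eventually_elim (rule \<xi>(2))
  qed
  ultimately have "m = l - l" by (rule tendsto_unique[OF trivial_limit_at_top_linorder])
  then show ?thesis by simp
qed

section \<open>The forcing term\<close>

text \<open>
  The velocity \<open>dy/dt = r y (3 - y)\<close> along the logistic solution \<open>y = 3/2 (1 + tanh (3rt/2))\<close>.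
\<close>
definition drive :: "real \<Rightarrow> real \<Rightarrow> real"
  where "drive r t = 9 * r / 4 * (1 - (tanh (3 * r / 2 * t))\<^sup>2)"

lemma tanh_square_less_1: "(tanh (x::real))\<^sup>2 < 1"
  using tanh_real_bounds[of x] by (simp add: abs_square_less_1 abs_less_iff)

lemma drive_pos: "r > 0 \<Longrightarrow> drive r t > 0"
  using tanh_square_less_1 by (simp add: drive_def)

lemma drive_le: "r > 0 \<Longrightarrow> drive r t \<le> 9 * r / 4"
  by (simp add: drive_def)

lemma drive_abs: "drive r \<bar>t\<bar> = drive r t"
  by (simp add: drive_def abs_if)

lemma drive_antimono:
  assumes "r > 0" "0 \<le> s" "s \<le> t"
  shows "drive r t \<le> drive r s"
  using assms by (auto simp: drive_def intro!: mult_left_mono power_mono)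

lemma drive_deriv:
  "(drive r has_real_derivative
      - (27 * r\<^sup>2 / 4) * tanh (3 * r / 2 * t) * (1 - (tanh (3 * r / 2 * t))\<^sup>2)) (at t)"
  unfolding drive_def
  by (auto intro!: derivative_eq_intros simp: field_simps power2_eq_square)

lemma drive_deriv_nonpos:
  fixes r t :: real
  assumes "r > 0" "t \<ge> 0"
  shows "- (27 * r\<^sup>2 / 4) * tanh (3 * r / 2 * t) * (1 - (tanh (3 * r / 2 * t))\<^sup>2) \<le> 0"
  using assms tanh_square_less_1[of "3 * r / 2 * t"]
  by (intro mult_nonpos_nonneg) auto

lemma tanh_ramp_tendsto:
  fixes r :: real
  shows "r > 0 \<Longrightarrow> ((\<lambda>t. tanh (3 * r / 2 * t)) \<longlongrightarrow> 1) at_top"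
  by (rule filterlim_compose[OF tanh_real_at_top])
     (intro filterlim_tendsto_pos_mult_at_top[OF tendsto_const] filterlim_ident, simp)

lemma drive_tendsto: 
  assumes "r > 0" shows "(drive r \<longlongrightarrow> 0) at_top"
proof -
  have "((\<lambda>t. 9 * r / 4 * (1 - (tanh (3 * r / 2 * t))\<^sup>2)) \<longlongrightarrow> 9 * r / 4 * (1 - 1\<^sup>2)) at_top"
    by (intro tendsto_intros tanh_ramp_tendsto assms)
  then show ?thesis by (simp add: drive_def[abs_def])
qed

lemma continuous_on_drive: "continuous_on A (drive r)"
  using drive_deriv by (meson DERIV_continuous continuous_at_imp_continuous_on)

section \<open>Half-orbits of the clamped system\<close>

definition clamp01 :: "real \<Rightarrow> real"
  where "clamp01 v = max 0 (min 1 v)"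

lemma clamp01_bounds: "0 \<le> clamp01 v" "clamp01 v \<le> 1"
  by (auto simp: clamp01_def)

text \<open>
  The half-orbit with initial amplitude \<open>q\<close>: here \<open>w\<close> is the integral of the clamped \<open>u\<close>, and
  \<open>q exp (-2w)\<close> stands for \<open>\<sigma>\<^sup>2 p\<close>. Derivatives at \<open>0\<close> are one-sided.
\<close>
locale clamped_orbit =
  fixes r q :: real and w u :: "real \<Rightarrow> real"
  assumes r: "0 < r" and q: "0 \<le> q"
    and w0: "w 0 = 0" and u0: "u 0 = 0"
    and dw: "\<And>t. 0 \<le> t \<Longrightarrow> (w has_real_derivative clamp01 (u t)) (at t within {0..})"
    and du: "\<And>t. 0 \<le> t \<Longrightarrow> (u has_real_derivative
               (clamp01 (u t))\<^sup>2 + (-1 + q * exp (-2 * w t) + drive r t)) (at t within {0..})"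
begin

definition forcing :: "real \<Rightarrow> real"
  where "forcing t = -1 + q * exp (-2 * w t) + drive r t"

lemma dw_at: "0 < t \<Longrightarrow> (w has_real_derivative clamp01 (u t)) (at t)"
  using dw[of t] by (simp add: at_within_halfline_interior)

lemma du_at: "0 < t \<Longrightarrow> (u has_real_derivative (clamp01 (u t))\<^sup>2 + forcing t) (at t)"
  using du[of t] by (simp add: at_within_halfline_interior forcing_def)

lemma continuous_w: "A \<subseteq> {0..} \<Longrightarrow> continuous_on A w"
  by (rule continuous_on_subset[OF DERIV_continuous_on[OF dw]]) auto

lemma continuous_u: "A \<subseteq> {0..} \<Longrightarrow> continuous_on A u"
  by (rule continuous_on_subset[OF DERIV_continuous_on[OF du]]) auto

lemma w_mono:
  assumes "0 \<le> s" "s \<le> t"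
  shows "w s \<le> w t"
proof (rule DERIV_nonneg_imp_increasing_open[where f = w and a = s and b = t])
  show "\<exists>y. (w has_real_derivative y) (at x) \<and> 0 \<le> y" if "s < x" "x < t" for x
    using dw_at[of x] that assms clamp01_bounds by (intro exI[of _ "clamp01 (u x)"]) auto
qed (use assms continuous_w in auto)

lemma w_le:
  assumes "0 \<le> t"
  shows "w t \<le> t"
proof -
  have "w t - t \<le> w 0 - 0"
  proof (rule DERIV_nonpos_imp_decreasing_open[where f = "\<lambda>t. w t - t"])
    show "\<exists>y. ((\<lambda>t. w t - t) has_real_derivative y) (at x) \<and> y \<le> 0" if "0 < x" "x < t" for x
      using dw_at[of x] that clamp01_bounds
      by (intro exI[of _ "clamp01 (u x) - 1"]) (auto intro!: derivative_eq_intros)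
    show "continuous_on {0..t} (\<lambda>t. w t - t)" by (intro continuous_intros continuous_w) auto
  qed (rule assms)
  then show ?thesis using w0 by simp
qed

lemma forcing_antimono:
  assumes "0 \<le> s" "s \<le> t"
  shows "forcing t \<le> forcing s"
  using w_mono[OF assms] drive_antimono[OF r assms] q
  by (auto simp: forcing_def intro!: add_mono mult_left_mono)

text \<open>
  Going back from \<open>a\<close>, if the forcing were nonnegative wherever \<open>u < 0\<close>, then \<open>u\<close> would only
  get smaller towards time \<open>0\<close>, contradicting \<open>u 0 = 0\<close>.
\<close>
lemma negative_turning_point:
  assumes "0 \<le> a" "u a < 0"
  shows "\<exists>s\<ge>0. s \<le> a \<and> u s < 0 \<and> forcing s < 0"
proof (rule ccontr)
  assume "\<not> ?thesis"
  then have *: "forcing s \<ge> 0" if "0 \<le> s" "s \<le> a" "u s < 0" for s using that by force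
  have "- u 0 > 0"
  proof (rule barrier_above_backwards[where f = "\<lambda>s. - u s"])
    show "continuous_on {0..a} (\<lambda>s. - u s)" by (intro continuous_intros continuous_u) auto
    show "\<exists>d. ((\<lambda>s. - u s) has_real_derivative d) (at s) \<and> d \<le> 0"
      if "0 < s" "s < a" "- u s > 0" for s
    proof (intro exI conjI)
      show "((\<lambda>s. - u s) has_real_derivative - ((clamp01 (u s))\<^sup>2 + forcing s)) (at s)"
        by (rule DERIV_minus[OF du_at[OF that(1)]])
      have "forcing s \<ge> 0" using * that by simp
      then show "- ((clamp01 (u s))\<^sup>2 + forcing s) \<le> 0"
        using zero_le_power2[of "clamp01 (u s)"] by linarith
    qed
  qed (use assms in auto)
  then show False using u0 by simp
qed

text \<open>
  Below \<open>0\<close> the clamped square vanishes and the forcing alone drives \<open>u\<close>; being nonincreasing, it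
  remains negative.
\<close>
lemma stays_negative:
  assumes "0 \<le> s" "s \<le> t" "u s < 0" "forcing s < 0"
  shows "u t < 0"
proof -
  have "- u t > 0"
  proof (rule barrier_above[where f = "\<lambda>s. - u s"])
    show "continuous_on {s..t} (\<lambda>s. - u s)"
      using assms by (intro continuous_intros continuous_u) auto
    show "\<exists>d. ((\<lambda>s. - u s) has_real_derivative d) (at x) \<and> d \<ge> 0"
      if "s < x" "x < t" "- u x > 0" for x
    proof (intro exI conjI)
      show "((\<lambda>s. - u s) has_real_derivative - ((clamp01 (u x))\<^sup>2 + forcing x)) (at x)"
        using that assms by (intro DERIV_minus du_at) auto
      show "- ((clamp01 (u x))\<^sup>2 + forcing x) \<ge> 0"
        using forcing_antimono[of s x] assms that by (simp add: clamp01_def)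
    qed
  qed (use assms in auto)
  then show ?thesis by simp
qed

text \<open>
  Above \<open>1\<close> the clamped square equals \<open>1\<close> and cancels the constant \<open>-1\<close>; what is left is
  positive.
\<close>
lemma stays_above_1:
  assumes "0 \<le> s" "s \<le> t" "u s > 1"
  shows "u t > 1"
proof (rule barrier_above[where f = u])
  show "continuous_on {s..t} u" using assms by (intro continuous_u) auto
  show "\<exists>d. (u has_real_derivative d) (at x) \<and> d \<ge> 0" if "s < x" "x < t" "u x > 1" for x
  proof (intro exI conjI)
    show "(u has_real_derivative (clamp01 (u x))\<^sup>2 + forcing x) (at x)"
      using that assms by (intro du_at) auto
    show "(clamp01 (u x))\<^sup>2 + forcing x \<ge> 0"
      using that q drive_pos[OF r, of x] by (simp add: clamp01_def forcing_def)
  qed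
qed (use assms in auto)

lemma exits_exclusive:
  assumes "0 \<le> a" "u a < 0" "0 \<le> b" "u b > 1"
  shows False
proof -
  obtain s where s: "s \<ge> 0" "u s < 0" "forcing s < 0"
    using negative_turning_point[OF assms(1,2)] by blast
  then have "u (max b s) < 0" using stays_negative[of s "max b s"] by simp
  moreover have "u (max b s) > 1" using assms stays_above_1[of b "max b s"] by simp
  ultimately show False by simp
qed

text \<open>
  Up to time \<open>1/2\<close> one has \<open>w \<le> 1/2\<close>, so the amplitude is at least \<open>12/e \<ge> 4\<close> and \<open>u\<close> grows with
  speed at least \<open>3\<close>.
\<close>
lemma large_amplitude_exits_above:
  assumes "q \<ge> 12"
  shows "u (1/2) > 1"
proof -
  have "u 0 - 3 * 0 \<le> u (1/2) - 3 * (1/2)"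
  proof (rule DERIV_nonneg_imp_increasing_open[where f = "\<lambda>t. u t - 3 * t"])
    show "continuous_on {0..1/2} (\<lambda>t. u t - 3 * t)" by (intro continuous_intros continuous_u) auto
    show "\<exists>y. ((\<lambda>t. u t - 3 * t) has_real_derivative y) (at x) \<and> 0 \<le> y"
      if x: "0 < x" "x < 1/2" for x
    proof (intro exI conjI)
      show "((\<lambda>t. u t - 3 * t) has_real_derivative (clamp01 (u x))\<^sup>2 + forcing x - 3) (at x)"
        using du_at[OF x(1)] by (auto intro!: derivative_eq_intros)
      have "exp (2 * w x) \<le> exp 1" using w_le[of x] x by simp
      then have "exp (2 * w x) \<le> 3" using exp_le by linarith
      then have "1 / 3 \<le> exp (-2 * w x)" by (simp add: exp_minus field_simps)
      then have "12 * (1 / 3) \<le> q * exp (-2 * w x)" using assms by (intro mult_mono) auto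
      then show "0 \<le> (clamp01 (u x))\<^sup>2 + forcing x - 3"
        using drive_pos[OF r, of x] zero_le_power2[of "clamp01 (u x)"]
        unfolding forcing_def by linarith
    qed
  qed auto
  then show ?thesis using u0 by simp
qed

text \<open>
  For \<open>q = 0\<close> the function \<open>T t = tanh (3rt/2)\<close> is a supersolution: \<open>T' = 3r/2 (1 - T\<^sup>2)\<close>, while
  \<open>T\<^sup>2 - 1 + drive r t = (9r/4 - 1) (1 - T\<^sup>2)\<close>, and \<open>9r/4 - 1 \<le> 3r/2\<close> is equivalent to \<open>r \<le> 4/3\<close>.
  Hence \<open>u\<close> cannot overtake \<open>T < 1\<close>.
\<close>
lemma zero_amplitude_below_1:
  assumes "q = 0" "r \<le> 4 / 3" "0 \<le> b"
  shows "u b \<le> 1"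
proof (rule ccontr)
  assume "\<not> u b \<le> 1"
  define T where "T = (\<lambda>t. tanh (3 * r / 2 * t))"
  have T: "T t < 1" "t \<ge> 0 \<Longrightarrow> 0 \<le> T t" for t
    using r by (auto simp: T_def tanh_real_lt_1)
  \<comment> \<open>Where \<open>u > T\<close>, the gap satisfies \<open>(u - T)' \<le> 2 (u - T)\<close>; the factor \<open>exp (-2t)\<close> turns this into monotonicity of \<open>E\<close>.\<close>
  define E where "E = (\<lambda>t. exp (-2 * t) * (u t - T t))"
  have "E 0 > 0"
  proof (rule barrier_above_backwards[where f = E and a = 0 and b = b])
    show "continuous_on {0..b} E"
      unfolding E_def T_def by (intro continuous_intros continuous_u) (auto simp: cosh_real_nonzero)
    have "u b > T b" using \<open>\<not> u b \<le> 1\<close> T(1)[of b] by simp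
    then show "E b > 0" by (simp add: E_def)
    fix t assume t: "0 < t" "t < b" "E t > 0"
    define D where "D = (clamp01 (u t))\<^sup>2 + forcing t - 3 * r / 2 * (1 - (T t)\<^sup>2)"
    have "(T has_real_derivative 3 * r / 2 * (1 - (T t)\<^sup>2)) (at t)"
      unfolding T_def by (auto intro!: derivative_eq_intros)
    with du_at[OF t(1)] have diff: "((\<lambda>t. u t - T t) has_real_derivative D) (at t)"
      unfolding D_def by (rule DERIV_diff)
    have "((\<lambda>t. exp (-2 * t)) has_real_derivative -2 * exp (-2 * t)) (at t)"
      by (auto intro!: derivative_eq_intros)
    from DERIV_mult[OF this diff]
    have "(E has_real_derivative exp (-2 * t) * (D - 2 * (u t - T t))) (at t)"
      unfolding E_def by (simp add: algebra_simps)
    moreover have "D \<le> 2 * (u t - T t)"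
    proof -
      have uT: "u t > T t" using t(3) by (simp add: E_def zero_less_mult_iff)
      have c: "T t \<le> clamp01 (u t)" "clamp01 (u t) \<le> u t"
        using uT T[of t] t(1) by (auto simp: clamp01_def)
      have "D = (clamp01 (u t) - T t) * (clamp01 (u t) + T t)
          - (1 - 3 * r / 4) * (1 - (T t)\<^sup>2)"
        unfolding D_def forcing_def drive_def T_def unfolding assms(1)
        by (simp add: field_simps power2_eq_square)
      also have "\<dots> \<le> (clamp01 (u t) - T t) * (clamp01 (u t) + T t)"
        using assms(2) tanh_square_less_1[of "3 * r / 2 * t"] by (simp add: T_def)
      also have "\<dots> \<le> (u t - T t) * 2"
        using c T[of t] t(1) clamp01_bounds[of "u t"] by (intro mult_mono) auto
      finally show ?thesis by simp
    qed
    ultimately show "\<exists>d. (E has_real_derivative d) (at t) \<and> d \<le> 0"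
      by (intro exI[of _ "exp (-2 * t) * (D - 2 * (u t - T t))"]) (auto intro!: mult_nonneg_nonpos)
  qed (rule assms)
  then show False by (simp add: E_def T_def u0)
qed

end

section \<open>Trapped orbits converge\<close>

text \<open>
  On these orbits the clamping is inactive, so they solve the original equations.
\<close>
locale trapped_orbit = clamped_orbit +
  assumes trapped: "\<And>t. 0 \<le> t \<Longrightarrow> 0 \<le> u t \<and> u t \<le> 1"
begin

definition speed :: "real \<Rightarrow> real"
  where "speed t = (u t)\<^sup>2 + forcing t"

lemma clamp01_u: "0 \<le> t \<Longrightarrow> clamp01 (u t) = u t"
  using trapped[of t] by (simp add: clamp01_def)

lemma u_deriv: "0 < t \<Longrightarrow> (u has_real_derivative speed t) (at t)"
  using du_at[of t] by (simp add: speed_def clamp01_u)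

lemma w_deriv: "0 < t \<Longrightarrow> (w has_real_derivative u t) (at t)"
  using dw_at[of t] by (simp add: clamp01_u)

text \<open>
  Differentiating \<open>u' = u\<^sup>2 - 1 + Q + g\<close> gives \<open>(u')' = 2u u' + (g' - 2uQ)\<close>, and \<open>exp (-2w)\<close> is the
  integrating factor of the homogeneous part; the remainder \<open>g' - 2uQ\<close> is nonpositive for
  \<open>t \<ge> 0\<close>.
\<close>
lemma scaled_speed_antimono:
  assumes "0 \<le> s" "s \<le> t"
  shows "speed t * exp (-2 * w t) \<le> speed s * exp (-2 * w s)"
proof (rule DERIV_nonpos_imp_decreasing_open[where f = "\<lambda>t. speed t * exp (-2 * w t)"])
  show "continuous_on {s..t} (\<lambda>t. speed t * exp (-2 * w t))"
    using assms unfolding speed_def forcing_def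
    by (intro continuous_intros continuous_u continuous_w continuous_on_drive) auto
  fix x assume "s < x" "x < t"
  then have x: "0 < x" using assms by simp
  define g' where
    "g' = - (27 * r\<^sup>2 / 4) * tanh (3 * r / 2 * x) * (1 - (tanh (3 * r / 2 * x))\<^sup>2)"
  have drive: "(drive r has_real_derivative g') (at x)" unfolding g'_def by (rule drive_deriv)
  have "((\<lambda>t. speed t * exp (-2 * w t)) has_real_derivative
      (g' - 2 * q * u x * exp (-2 * w x)) * exp (-2 * w x)) (at x)"
    unfolding speed_def forcing_def
  proof -
    have e: "((\<lambda>t. exp (-2 * w t)) has_real_derivative -2 * u x * exp (-2 * w x)) (at x)"
      using w_deriv[OF x] by (auto intro!: derivative_eq_intros)
    have "((\<lambda>t. (u t)\<^sup>2 + (-1 + q * exp (-2 * w t) + drive r t)) has_real_derivative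
        2 * u x * speed x + (q * (-2 * u x * exp (-2 * w x)) + g')) (at x)"
      by (rule derivative_eq_intros u_deriv[OF x] e drive refl)+ simp
    from DERIV_mult[OF this e]
    show "((\<lambda>t. ((u t)\<^sup>2 + (-1 + q * exp (-2 * w t) + drive r t)) * exp (-2 * w t))
        has_real_derivative (g' - 2 * q * u x * exp (-2 * w x)) * exp (-2 * w x)) (at x)"
      by (simp add: speed_def forcing_def algebra_simps power2_eq_square)
  qed
  moreover have "g' \<le> 0" unfolding g'_def using drive_deriv_nonpos r x by simp
  moreover have "0 \<le> q * u x * exp (-2 * w x)" using trapped[of x] x q by simp
  ultimately show "\<exists>y. ((\<lambda>t. speed t * exp (-2 * w t)) has_real_derivative y) (at x) \<and> y \<le> 0"
    by (intro exI[of _ "(g' - 2 * q * u x * exp (-2 * w x)) * exp (-2 * w x)"])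
       (auto intro!: mult_nonpos_nonneg)
qed (rule assms)

text \<open>
  By the previous lemma the speed, once nonpositive, stays so: \<open>u\<close> is either increasing throughout
  or eventually decreasing.
\<close>
lemma u_convergent: "\<exists>l. (u \<longlongrightarrow> l) at_top"
proof (cases "\<exists>T\<ge>0. speed T \<le> 0")
  case True
  then obtain T where T: "T \<ge> 0" "speed T \<le> 0" by blast
  have neg: "speed x \<le> 0" if "T \<le> x" for x
  proof -
    have "speed x * exp (-2 * w x) \<le> speed T * exp (-2 * w T)"
      using T that by (intro scaled_speed_antimono)
    also have "\<dots> \<le> 0" using T by (intro mult_nonpos_nonneg) auto
    finally show ?thesis by (simp add: mult_le_0_iff not_le)
  qed
  show ?thesis
  proof (rule antimono_bounded_tendsto_at_top)
    show "u t \<le> u s" if "T \<le> s" "s \<le> t" for s t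
    proof (rule DERIV_nonpos_imp_decreasing_open[where f = u])
      show "\<exists>y. (u has_real_derivative y) (at x) \<and> y \<le> 0" if "s < x" "x < t" for x
        using u_deriv[of x] neg[of x] that T \<open>T \<le> s\<close> by (intro exI[of _ "speed x"]) auto
    qed (use that T continuous_u in auto)
    show "0 \<le> u t" if "T \<le> t" for t using trapped[of t] that T by simp
  qed
next
  case False
  show ?thesis
  proof (rule mono_bounded_tendsto_at_top)
    show "u s \<le> u t" if "0 \<le> s" "s \<le> t" for s t
    proof (rule DERIV_nonneg_imp_increasing_open[where f = u])
      show "\<exists>y. (u has_real_derivative y) (at x) \<and> 0 \<le> y" if "s < x" "x < t" for x
      proof (intro exI conjI)
        show "(u has_real_derivative speed x) (at x)" using that \<open>0 \<le> s\<close> by (intro u_deriv) auto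
        show "0 \<le> speed x" using False that \<open>0 \<le> s\<close> by (meson le_less_trans less_imp_le not_le)
      qed
    qed (use that continuous_u in auto)
    show "u t \<le> 1" if "0 \<le> t" for t using trapped[of t] that by simp
  qed
qed

lemma amplitude_antimono:
  assumes "0 \<le> s" "s \<le> t"
  shows "q * exp (-2 * w t) \<le> q * exp (-2 * w s)"
  using w_mono[OF assms] q by (intro mult_left_mono) auto

theorem trapped_limits:
  "(u \<longlongrightarrow> 1) at_top" "((\<lambda>t. q * exp (-2 * w t)) \<longlongrightarrow> 0) at_top"
proof -
  obtain l where l: "(u \<longlongrightarrow> l) at_top" using u_convergent by blast
  have "\<forall>\<^sub>F t in at_top. 0 \<le> u t"
    using eventually_ge_at_top[of 0] by eventually_elim (simp add: trapped)
  then have l0: "0 \<le> l" using l by (intro tendsto_lowerbound[OF l]) auto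
  obtain Q where Q: "((\<lambda>t. q * exp (-2 * w t)) \<longlongrightarrow> Q) at_top"
    using antimono_bounded_tendsto_at_top[of 0 "\<lambda>t. q * exp (-2 * w t)" 0] amplitude_antimono q
    by auto
  have "((\<lambda>t. (u t)\<^sup>2 + (-1 + q * exp (-2 * w t) + drive r t)) \<longlongrightarrow> l\<^sup>2 + (-1 + Q + 0)) at_top"
    by (intro tendsto_intros l Q drive_tendsto r)
  then have "(speed \<longlongrightarrow> l\<^sup>2 + (-1 + Q + 0)) at_top" by (simp add: speed_def[abs_def] forcing_def)
  then have balance: "l\<^sup>2 + Q = 1"
    using tendsto_deriv_limit_zero[of 0 u speed, OF u_deriv l] by force
  \<comment> \<open>Otherwise \<open>q exp (-2w)\<close> decreases to \<open>Q = 1\<close> and never falls below it, and \<open>u\<close> would increase strictly from \<open>0\<close>.\<close>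
  have "l \<noteq> 0"
  proof
    assume "l = 0"
    with balance have "Q = 1" by simp
    have amp: "1 \<le> q * exp (-2 * w t)" if "0 \<le> t" for t
    proof (rule tendsto_upperbound[OF Q[unfolded \<open>Q = 1\<close>]])
      show "\<forall>\<^sub>F s in at_top. q * exp (-2 * w s) \<le> q * exp (-2 * w t)"
        using eventually_ge_at_top[of t] by eventually_elim (use that amplitude_antimono in blast)
    qed simp
    have incr: "u s < u t" if "0 \<le> s" "s < t" for s t
    proof (rule DERIV_pos_imp_increasing_open[where f = u])
      show "\<exists>y. (u has_real_derivative y) (at x) \<and> 0 < y" if "s < x" "x < t" for x
      proof (intro exI conjI)
        show "(u has_real_derivative speed x) (at x)" using that \<open>0 \<le> s\<close> by (intro u_deriv) auto
        have "0 \<le> -1 + q * exp (-2 * w x)" using amp[of x] that \<open>0 \<le> s\<close> by simp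
        then show "0 < speed x" unfolding speed_def forcing_def
          using drive_pos[OF r, of x] zero_le_power2[of "u x"] by linarith
      qed
    qed (use that continuous_u in auto)
    have "\<forall>\<^sub>F t in at_top. u 1 \<le> u t"
      using eventually_gt_at_top[of 1] by eventually_elim (use incr[of 1] in \<open>simp add: less_imp_le\<close>)
    then have "u 1 \<le> l" using l by (intro tendsto_lowerbound[OF l]) auto
    then show False using incr[of 0 1] u0 \<open>l = 0\<close> by simp
  qed
  with l0 have lpos: "l > 0" by simp
  \<comment> \<open>A positive limit of \<open>u = w'\<close> forces \<open>w\<close> to infinity at least linearly.\<close>
  have "\<forall>\<^sub>F t in at_top. l / 2 < u t" using order_tendstoD(1)[OF l, of "l/2"] lpos by simp
  then obtain T0 where T0: "\<And>t. t \<ge> T0 \<Longrightarrow> l / 2 < u t" by (auto simp: eventually_at_top_linorder)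
  define T where "T = max T0 0"
  have T: "T \<ge> 0" and uT: "\<And>t. t \<ge> T \<Longrightarrow> l / 2 < u t" using T0 by (auto simp: T_def)
  have "filterlim w at_top at_top"
  proof (rule filterlim_at_top_mono)
    show "filterlim (\<lambda>t. (w T - l / 2 * T) + l / 2 * t) at_top at_top"
      using lpos by (intro filterlim_tendsto_add_at_top[OF tendsto_const]
          filterlim_tendsto_pos_mult_at_top[OF tendsto_const] filterlim_ident) auto
    have "(w T - l / 2 * T) + l / 2 * t \<le> w t" if "t \<ge> T" for t
    proof -
      have "w T - l / 2 * T \<le> w t - l / 2 * t"
      proof (rule DERIV_nonneg_imp_increasing_open[where f = "\<lambda>t. w t - l / 2 * t"])
        show "\<exists>y. ((\<lambda>t. w t - l / 2 * t) has_real_derivative y) (at x) \<and> 0 \<le> y"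
          if "T < x" "x < t" for x
          using w_deriv[of x] uT[of x] that T
          by (intro exI[of _ "u x - l / 2"]) (auto intro!: derivative_eq_intros)
        show "continuous_on {T..t} (\<lambda>t. w t - l / 2 * t)"
          using T by (intro continuous_intros continuous_w) auto
      qed (rule that)
      then show ?thesis by simp
    qed
    then show "\<forall>\<^sub>F t in at_top. (w T - l / 2 * T) + l / 2 * t \<le> w t"
      using eventually_ge_at_top[of T] by (rule eventually_mono[rotated])
  qed
  then have "filterlim (\<lambda>t. - (2 * w t)) at_bot at_top"
    by (intro filterlim_compose[OF filterlim_uminus_at_bot_at_top]
        filterlim_tendsto_pos_mult_at_top[OF tendsto_const]) auto
  then have "((\<lambda>t. exp (-2 * w t)) \<longlongrightarrow> 0) at_top"
    using filterlim_compose[OF exp_at_bot] by simp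
  then have "((\<lambda>t. q * exp (-2 * w t)) \<longlongrightarrow> q * 0) at_top" by (intro tendsto_intros)
  then show Q0: "((\<lambda>t. q * exp (-2 * w t)) \<longlongrightarrow> 0) at_top" by simp
  have "Q = 0" using tendsto_unique[OF _ Q Q0] by simp
  with balance have "l\<^sup>2 = 1\<^sup>2" by simp
  then have "l = 1" using l0 by (intro power2_eq_imp_eq[of l 1]) auto
  then show "(u \<longlongrightarrow> 1) at_top" using l by simp
qed

end

section \<open>Shooting in the initial amplitude\<close>

text \<open>
  Truncating the amplitude makes the field bounded and Lipschitz, and lets the shooting parameter
  range over the whole connected real line. The bound \<open>12\<close> is the amplitude for which the orbit is
  known to exit above.
\<close>
definition amp :: "real \<Rightarrow> real"
  where "amp q = max 0 (min 12 q)"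

text \<open>
  The shooting parameter is carried along as a constant third component, so that dependence on it
  is dependence on initial data. Only the half-line \<open>w \<ge> 0\<close> matters for solutions; the maximum keeps
  the exponential Lipschitz elsewhere.
\<close>
definition clamped_field :: "real \<Rightarrow> real \<Rightarrow> real \<times> real \<times> real \<Rightarrow> real \<times> real \<times> real"
  where "clamped_field r t = (\<lambda>(w, u, q).
    (clamp01 u, (clamp01 u)\<^sup>2 + (-1 + amp q * exp (-2 * max 0 w) + drive r t), 0))"

lemma continuous_clamped_field: "continuous_on UNIV (\<lambda>(t, x). clamped_field r t x)"
  unfolding clamped_field_def clamp01_def amp_def case_prod_unfold
  by (intro continuous_intros continuous_on_compose2[OF continuous_on_drive]) auto

lemma exp_minus_Lipschitz:
  fixes a b :: real
  assumes "0 \<le> a" "0 \<le> b"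
  shows "\<bar>exp (- a) - exp (- b)\<bar> \<le> \<bar>a - b\<bar>"
proof -
  have *: "exp (- x) - exp (- y) \<le> y - x \<and> exp (- y) \<le> exp (- x)" if "0 \<le> x" "x \<le> y" for x y :: real
  proof -
    have "exp (- x) - exp (- y) = exp (- x) * (1 - exp (- (y - x)))"
      by (simp add: algebra_simps flip: exp_add)
    also have "\<dots> \<le> 1 * (y - x)"
    proof (rule mult_mono)
      show "1 - exp (- (y - x)) \<le> y - x" using exp_ge_add_one_self[of "- (y - x)"] by linarith
    qed (use that in auto)
    finally show ?thesis using that by simp
  qed
  show ?thesis using *[of a b] *[of b a] assms by linarith
qed

lemma clamped_field_Lipschitz:
  "norm (clamped_field r t x - clamped_field r t y) \<le> 28 * norm (x - y)"
proof -
  obtain w u q where x: "x = (w, u, q)" by (cases x)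
  obtain w' u' q' where y: "y = (w', u', q')" by (cases y)
  define N where "N = norm (x - y)"
  have N: "\<bar>w - w'\<bar> \<le> N" "\<bar>u - u'\<bar> \<le> N" "\<bar>q - q'\<bar> \<le> N"
    using norm_fst_le[of "w - w'" "(u - u', q - q')"] norm_snd_le[of "(u - u', q - q')" "w - w'"]
      norm_fst_le[of "u - u'" "q - q'"] norm_snd_le[of "q - q'" "u - u'"]
    unfolding N_def x y by simp_all
  have c: "\<bar>clamp01 u - clamp01 u'\<bar> \<le> N" using N(2) by (auto simp: clamp01_def)
  have "\<bar>(clamp01 u)\<^sup>2 - (clamp01 u')\<^sup>2\<bar> = \<bar>clamp01 u - clamp01 u'\<bar> * \<bar>clamp01 u + clamp01 u'\<bar>"
    by (simp add: power2_eq_square square_diff_square_factored abs_mult mult.commute)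
  also have "\<dots> \<le> N * 2"
    using c clamp01_bounds[of u] clamp01_bounds[of u'] by (intro mult_mono) auto
  finally have c2: "\<bar>(clamp01 u)\<^sup>2 - (clamp01 u')\<^sup>2\<bar> \<le> 2 * N" by simp
  define e e' where "e = exp (- (2 * max 0 w))" and "e' = exp (- (2 * max 0 w'))"
  have e: "\<bar>e - e'\<bar> \<le> 2 * N"
    using exp_minus_Lipschitz[of "2 * max 0 w" "2 * max 0 w'"] N(1) max.cobounded1
    unfolding e_def e'_def by linarith
  have e01: "0 \<le> e'" "e' \<le> 1" by (auto simp: e'_def)
  have "\<bar>amp q * e - amp q' * e'\<bar> = \<bar>amp q * (e - e') + (amp q - amp q') * e'\<bar>"
    by (simp add: algebra_simps)
  also have "\<dots> \<le> \<bar>amp q\<bar> * \<bar>e - e'\<bar> + \<bar>amp q - amp q'\<bar> * \<bar>e'\<bar>"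
    by (metis abs_mult abs_triangle_ineq)
  also have "\<dots> \<le> 12 * (2 * N) + N * 1"
    using e e01 N(3) by (intro add_mono mult_mono) (auto simp: amp_def)
  finally have q: "\<bar>amp q * e - amp q' * e'\<bar> \<le> 25 * N" by simp
  have "clamped_field r t x - clamped_field r t y
      = (clamp01 u - clamp01 u', ((clamp01 u)\<^sup>2 - (clamp01 u')\<^sup>2) + (amp q * e - amp q' * e'), 0)"
    by (simp add: clamped_field_def x y e_def e'_def)
  also have "norm \<dots> \<le> \<bar>clamp01 u - clamp01 u'\<bar>
      + (\<bar>((clamp01 u)\<^sup>2 - (clamp01 u')\<^sup>2) + (amp q * e - amp q' * e')\<bar> + 0)"
    by (intro order_trans[OF norm_Pair_le] add_mono) auto
  also have "\<dots> \<le> N + ((2 * N + 25 * N) + 0)"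
    using c c2 q by linarith
  finally show ?thesis by (simp add: N_def)
qed

lemma clamped_field_bounded:
  assumes "r > 0"
  shows "norm (clamped_field r t x) \<le> 15 + 9 * r / 4"
proof -
  obtain w u q where x: "x = (w, u, q)" by (cases x)
  have a: "\<bar>amp q * exp (-2 * max 0 w)\<bar> \<le> 12 * 1"
    unfolding abs_mult by (intro mult_mono) (auto simp: amp_def)
  have "(clamp01 u)\<^sup>2 \<le> 1" using clamp01_bounds[of u] by (simp add: power_le_one)
  then have b: "\<bar>(clamp01 u)\<^sup>2 + (-1 + amp q * exp (-2 * max 0 w) + drive r t)\<bar> \<le> 14 + 9 * r / 4"
    using a drive_pos[OF assms, of t] drive_le[OF assms, of t] zero_le_power2[of "clamp01 u"]
    by linarith
  have "norm (clamped_field r t x) \<le> \<bar>clamp01 u\<bar>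
      + (\<bar>(clamp01 u)\<^sup>2 + (-1 + amp q * exp (-2 * max 0 w) + drive r t)\<bar> + 0)"
    unfolding clamped_field_def x prod.case
    by (intro order_trans[OF norm_Pair_le] add_mono) auto
  also have "\<dots> \<le> 1 + ((14 + 9 * r / 4) + 0)"
    using b clamp01_bounds[of u] by (intro add_mono) auto
  finally show ?thesis by simp
qed

lemma clamped_orbit_family:
  assumes r: "0 < r"
  obtains w u where "\<And>q. clamped_orbit r (amp q) (w q) (u q)"
    and "\<And>t. 0 \<le> t \<Longrightarrow> continuous_on UNIV (\<lambda>q. u q t)"
proof -
  have "\<forall>q. \<exists>X. X 0 = (0, 0, q) \<and>
      (\<forall>t\<ge>0. (X has_vector_derivative clamped_field r t (X t)) (at t within {0..}))"
    using picard_lindelof_halfline[OF continuous_clamped_field clamped_field_Lipschitz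
        clamped_field_bounded[OF r]] by blast
  then obtain X where X0: "\<And>q. X q 0 = (0, 0, q)"
    and X: "\<And>q t. 0 \<le> t \<Longrightarrow> (X q has_vector_derivative clamped_field r t (X q t)) (at t within {0..})"
    by metis
  define w u where "w = (\<lambda>q t. fst (X q t))" and "u = (\<lambda>q t. fst (snd (X q t)))"
  have deriv_lin: "((\<lambda>t. g (X q t)) has_real_derivative g (clamped_field r t (X q t))) (at t within {0..})"
    if "bounded_linear g" "0 \<le> t" for g q t
    using bounded_linear.has_vector_derivative[OF that(1) X[OF that(2)]]
    by (simp add: has_real_derivative_iff_has_vector_derivative)
  have dq: "((\<lambda>t. snd (snd (X q t))) has_real_derivative 0) (at t within {0..})"
    if "0 \<le> t" for q t
    using deriv_lin[OF bounded_linear_snd_comp[OF bounded_linear_snd] that, of q]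
    by (simp add: clamped_field_def case_prod_unfold)
  have q_const: "snd (snd (X q t)) = q" if "0 \<le> t" for q t
  proof -
    have "snd (snd (X q t)) = snd (snd (X q 0))"
      using has_field_derivative_zero_constant[of "{0..}" "\<lambda>t. snd (snd (X q t))"] dq[of _ q] that
      by (metis atLeast_iff convex_real_interval(1) order_refl)
    then show ?thesis by (simp add: X0)
  qed
  have dw: "(w q has_real_derivative clamp01 (u q t)) (at t within {0..})" if "0 \<le> t" for q t
    using deriv_lin[OF bounded_linear_fst that, of q]
    by (simp add: clamped_field_def case_prod_unfold w_def u_def)
  have w_nonneg: "0 \<le> w q t" if "0 \<le> t" for q t
  proof -
    have "w q 0 \<le> w q t"
    proof (rule DERIV_nonneg_imp_increasing_open[where f = "w q"])
      show "continuous_on {0..t} (w q)"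
        by (rule continuous_on_subset[OF DERIV_continuous_on[OF dw]]) auto
      show "\<exists>y. (w q has_real_derivative y) (at x) \<and> 0 \<le> y" if "0 < x" "x < t" for x
        using dw[of x q] that clamp01_bounds[of "u q x"]
        by (auto simp: at_within_halfline_interior)
    qed (rule that)
    then show ?thesis by (simp add: w_def X0)
  qed
  have du: "(u q has_real_derivative
      (clamp01 (u q t))\<^sup>2 + (-1 + amp q * exp (-2 * w q t) + drive r t)) (at t within {0..})"
    if "0 \<le> t" for q t
    using deriv_lin[OF bounded_linear_fst_comp[OF bounded_linear_snd] that, of q]
      w_nonneg[OF that, of q] q_const[OF that, of q]
    by (simp add: clamped_field_def case_prod_unfold w_def u_def max_absorb2)
  show ?thesis
  proof
    show "clamped_orbit r (amp q) (w q) (u q)" for q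
      by unfold_locales (use r dw du in \<open>auto simp: w_def u_def X0 amp_def\<close>)
    show "continuous_on UNIV (\<lambda>q. u q t)" if "0 \<le> t" for t
    proof (rule lipschitz_on_continuous_on)
      show "(exp (28 * t))-lipschitz_on UNIV (\<lambda>q. u q t)"
      proof (rule lipschitz_onI)
        fix q q'
        have "norm (fst (snd x)) \<le> norm x" for x :: "real \<times> real \<times> real"
          using norm_fst_le[of "fst (snd x)" "snd (snd x)"] norm_snd_le[of "snd x" "fst x"] by simp
        from this[of "X q t - X q' t"] have "dist (u q t) (u q' t) \<le> norm (X q t - X q' t)"
          by (simp add: dist_norm u_def)
        also have "\<dots> \<le> exp (28 * t) * norm (X q 0 - X q' 0)"
          by (rule gronwall_dist[OF clamped_field_Lipschitz X X that])
        also have "\<dots> = exp (28 * t) * dist q q'" by (simp add: X0 dist_norm)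
        finally show "dist (u q t) (u q' t) \<le> exp (28 * t) * dist q q'" .
      qed simp
    qed
  qed
qed

lemma trapped_orbit_exists:
  assumes r: "0 < r" "r \<le> 4 / 3"
  shows "\<exists>q w u. trapped_orbit r q w u"
proof (rule ccontr)
  assume none: "\<not> ?thesis"
  obtain w u where orbit: "\<And>q. clamped_orbit r (amp q) (w q) (u q)"
    and cont: "\<And>t. 0 \<le> t \<Longrightarrow> continuous_on UNIV (\<lambda>q. u q t)"
    using clamped_orbit_family[OF r(1)] by blast
  define A where "A = (\<Union>t\<in>{0..}. {q. 1 < u q t})"
  define B where "B = (\<Union>t\<in>{0..}. {q. u q t < 0})"
  have "open A" "open B"
    unfolding A_def B_def
    by (intro open_UN ballI open_Collect_less continuous_on_const cont; simp)+
  moreover have "A \<inter> B = {}"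
    using clamped_orbit.exits_exclusive[OF orbit] by (auto simp: A_def B_def)
  moreover have AB: "A \<union> B = UNIV"
  proof -
    have "\<exists>t\<ge>0. u q t < 0 \<or> 1 < u q t" for q
    proof (rule ccontr)
      assume "\<not> ?thesis"
      then have "trapped_orbit r (amp q) (w q) (u q)"
        by (intro trapped_orbit.intro trapped_orbit_axioms.intro orbit) force
      with none show False by blast
    qed
    then show ?thesis by (fastforce simp: A_def B_def)
  qed
  moreover have "12 \<in> A"
    using clamped_orbit.large_amplitude_exits_above[OF orbit[of 12]]
    by (force simp: A_def amp_def)
  moreover have "0 \<notin> A"
    using clamped_orbit.zero_amplitude_below_1[OF orbit[of 0] _ r(2)]
    by (force simp: A_def amp_def)
  then have "0 \<in> B" using AB by blast
  ultimately show False
    using connectedD[OF connected_UNIV, of A B] by auto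
qed

section \<open>Reflection to a heteroclinic orbit\<close>

lemma filterlim_abs_at_0: "filterlim abs (at 0 within {0..}) (at (0::real))"
  by (auto simp: filterlim_at eventually_at_filter intro!: tendsto_eq_intros)

text \<open>
  Away from \<open>0\<close> this and the next lemma are the chain rule; at \<open>0\<close> the two-sided difference quotient is, up to sign, the one-sided quotient
  composed with the absolute value.
\<close>
lemma has_real_derivative_odd_extension:
  fixes f f' :: "real \<Rightarrow> real"
  assumes d: "\<And>t. 0 \<le> t \<Longrightarrow> (f has_real_derivative f' t) (at t within {0..})" and f0: "f 0 = 0"
  shows "((\<lambda>t. sgn t * f \<bar>t\<bar>) has_real_derivative f' \<bar>t\<bar>) (at t)"
proof (cases t "0 :: real" rule: linorder_cases)
  case greater
  have "(f has_real_derivative f' t) (at t)"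
    using d[of t] greater by (simp add: at_within_halfline_interior)
  then have "((\<lambda>t. sgn t * f \<bar>t\<bar>) has_real_derivative f' t) (at t)"
    by (rule has_field_derivative_transform_within_open[where S = "{0<..}"]) (use greater in auto)
  then show ?thesis using greater by simp
next
  case less
  have "(f has_real_derivative f' (- t)) (at (- t))"
    using d[of "- t"] less by (simp add: at_within_halfline_interior)
  then have "((\<lambda>t. - f (- t)) has_real_derivative - (- f' (- t))) (at t)"
    by (intro DERIV_minus) (simp add: DERIV_mirror)
  then have "((\<lambda>t. sgn t * f \<bar>t\<bar>) has_real_derivative - (- f' (- t))) (at t)"
    by (rule has_field_derivative_transform_within_open[where S = "{..<0}"]) (use less in auto)
  then show ?thesis using less by simp
next
  case equal
  have "((\<lambda>y. f y / y) \<longlongrightarrow> f' 0) (at 0 within {0..})"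
    using d[of 0] f0 by (simp add: has_field_derivative_iff)
  from filterlim_compose[OF this filterlim_abs_at_0]
  have "((\<lambda>y. f \<bar>y\<bar> / \<bar>y\<bar>) \<longlongrightarrow> f' 0) (at 0)" .
  moreover have "f \<bar>y\<bar> / \<bar>y\<bar> = sgn y * f \<bar>y\<bar> / y" for y :: real
    by (auto simp: sgn_real_def abs_if)
  ultimately show ?thesis using equal f0 by (simp add: has_field_derivative_iff)
qed

lemma has_real_derivative_even_extension:
  fixes f f' :: "real \<Rightarrow> real"
  assumes d: "\<And>t. 0 \<le> t \<Longrightarrow> (f has_real_derivative f' t) (at t within {0..})" and f0: "f' 0 = 0"
  shows "((\<lambda>t. f \<bar>t\<bar>) has_real_derivative sgn t * f' \<bar>t\<bar>) (at t)"
proof (cases t "0 :: real" rule: linorder_cases)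
  case greater
  have "(f has_real_derivative f' t) (at t)"
    using d[of t] greater by (simp add: at_within_halfline_interior)
  then have "((\<lambda>t. f \<bar>t\<bar>) has_real_derivative f' t) (at t)"
    by (rule has_field_derivative_transform_within_open[where S = "{0<..}"]) (use greater in auto)
  then show ?thesis using greater by simp
next
  case less
  have "(f has_real_derivative f' (- t)) (at (- t))"
    using d[of "- t"] less by (simp add: at_within_halfline_interior)
  then have "((\<lambda>t. f (- t)) has_real_derivative - f' (- t)) (at t)"
    by (simp add: DERIV_mirror)
  then have "((\<lambda>t. f \<bar>t\<bar>) has_real_derivative - f' (- t)) (at t)"
    by (rule has_field_derivative_transform_within_open[where S = "{..<0}"]) (use less in auto)
  then show ?thesis using less by simp
next
  case equal
  have "((\<lambda>y. (f y - f 0) / y) \<longlongrightarrow> 0) (at 0 within {0..})"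
    using d[of 0] f0 by (simp add: has_field_derivative_iff)
  from filterlim_compose[OF this filterlim_abs_at_0]
  have "((\<lambda>y. \<bar>(f \<bar>y\<bar> - f 0) / \<bar>y\<bar>\<bar>) \<longlongrightarrow> 0) (at 0)" by (rule tendsto_rabs_zero)
  then have "((\<lambda>y. \<bar>(f \<bar>y\<bar> - f 0) / y\<bar>) \<longlongrightarrow> 0) (at 0)"
    by (simp add: abs_divide)
  then have "((\<lambda>y. (f \<bar>y\<bar> - f 0) / y) \<longlongrightarrow> 0) (at 0)"
    by (rule tendsto_rabs_zero_cancel)
  then show ?thesis using equal by (simp add: has_field_derivative_iff)
qed

context trapped_orbit
begin

text \<open>
  The coordinates of the reflected orbit: \<open>U = x + y\<close>, \<open>Y = y\<close> and \<open>Q = \<sigma>\<^sup>2 p\<close>.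
\<close>
definition U :: "real \<Rightarrow> real"
  where "U t = sgn t * u \<bar>t\<bar>"

definition Y :: "real \<Rightarrow> real"
  where "Y t = 3 / 2 * (1 + tanh (3 * r / 2 * t))"

definition Q :: "real \<Rightarrow> real"
  where "Q t = q * exp (-2 * w \<bar>t\<bar>)"

lemma U_deriv: "(U has_real_derivative (U t)\<^sup>2 - 1 + Q t + drive r t) (at t)"
proof -
  have "(u has_real_derivative speed t) (at t within {0..})" if "0 \<le> t" for t
    using du[OF that] clamp01_u[OF that] by (simp add: speed_def forcing_def)
  from has_real_derivative_odd_extension[OF this u0]
  have "(U has_real_derivative speed \<bar>t\<bar>) (at t)" unfolding U_def[abs_def] by simp
  moreover have "speed \<bar>t\<bar> = (U t)\<^sup>2 - 1 + Q t + drive r t"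
    by (simp add: speed_def forcing_def U_def Q_def drive_abs sgn_if u0)
  ultimately show ?thesis by simp
qed

lemma Q_deriv: "(Q has_real_derivative - 2 * U t * Q t) (at t)"
proof -
  have "(w has_real_derivative u t) (at t within {0..})" if "0 \<le> t" for t
    using dw[OF that] clamp01_u[OF that] by simp
  from has_real_derivative_even_extension[OF this u0]
  have "((\<lambda>t. w \<bar>t\<bar>) has_real_derivative U t) (at t)" unfolding U_def by simp
  then show ?thesis unfolding Q_def[abs_def] by (auto intro!: derivative_eq_intros)
qed

lemma Y_deriv: "(Y has_real_derivative drive r t) (at t)"
  unfolding Y_def[abs_def] drive_def
  by (auto intro!: derivative_eq_intros simp: field_simps)

lemma drive_Y: "drive r t = r * Y t * (3 - Y t)"
  by (simp add: drive_def Y_def field_simps power2_eq_square)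

lemma limits_at_top: "(U \<longlongrightarrow> 1) at_top" "(Q \<longlongrightarrow> 0) at_top" "(Y \<longlongrightarrow> 3) at_top"
proof -
  have "\<forall>\<^sub>F t in at_top. u t = U t"
    using eventually_gt_at_top[of 0] by eventually_elim (simp add: U_def)
  then show "(U \<longlongrightarrow> 1) at_top" by (rule Lim_transform_eventually[OF trapped_limits(1)])
  have "\<forall>\<^sub>F t in at_top. q * exp (-2 * w t) = Q t"
    using eventually_gt_at_top[of 0] by eventually_elim (simp add: Q_def)
  then show "(Q \<longlongrightarrow> 0) at_top" by (rule Lim_transform_eventually[OF trapped_limits(2)])
  have "(Y \<longlongrightarrow> 3 / 2 * (1 + 1)) at_top"
    unfolding Y_def[abs_def] by (intro tendsto_intros tanh_ramp_tendsto r)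
  then show "(Y \<longlongrightarrow> 3) at_top" by simp
qed

lemma limits_at_bot: "(U \<longlongrightarrow> -1) at_bot" "(Q \<longlongrightarrow> 0) at_bot" "(Y \<longlongrightarrow> 0) at_bot"
proof -
  have "U (- t) = - U t" "Q (- t) = Q t" "Y (- t) = 3 - Y t" for t
    by (simp_all add: U_def Q_def Y_def sgn_minus field_simps)
  moreover have "((\<lambda>t. 3 - Y t) \<longlongrightarrow> 3 - 3) at_top" by (intro tendsto_intros limits_at_top)
  ultimately show "(U \<longlongrightarrow> -1) at_bot" "(Q \<longlongrightarrow> 0) at_bot" "(Y \<longlongrightarrow> 0) at_bot"
    unfolding filterlim_at_bot_mirror using limits_at_top tendsto_minus[OF limits_at_top(1)] by simp_all
qed

lemma reflected_heteroclinic: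
  assumes "\<sigma> > 0"
  shows "heteroclinic_connection (vfield \<sigma> r) s\<^sub>1 s\<^sub>2 (\<lambda>t. (U t - Y t, Q t / \<sigma>\<^sup>2, Y t))"
  unfolding heteroclinic_connection_def is_equilibrium_def is_global_solution_def
proof (intro conjI allI)
  show "vfield \<sigma> r s\<^sub>1 = 0" "vfield \<sigma> r s\<^sub>2 = 0"
    by (simp_all add: vfield_def s\<^sub>1_def s\<^sub>2_def zero_prod_def)
  show "((\<lambda>t. (U t - Y t, Q t / \<sigma>\<^sup>2, Y t)) has_vector_derivative
      vfield \<sigma> r (U t - Y t, Q t / \<sigma>\<^sup>2, Y t)) (at t)" for t
  proof -
    have "vfield \<sigma> r (U t - Y t, Q t / \<sigma>\<^sup>2, Y t) =
        (((U t)\<^sup>2 - 1 + Q t + drive r t) - drive r t, (- 2 * U t * Q t) / \<sigma>\<^sup>2, drive r t)"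
      using assms by (simp add: vfield_def drive_Y)
    then show ?thesis
      by (simp only:)
         (intro has_vector_derivative_Pair DERIV_diff DERIV_cdivide U_deriv Q_deriv Y_deriv
           has_real_derivative_iff_has_vector_derivative[THEN iffD1])
  qed
  have "((\<lambda>t. (U t - Y t, Q t / \<sigma>\<^sup>2, Y t)) \<longlongrightarrow> (-1 - 0, 0 / \<sigma>\<^sup>2, 0)) at_bot"
    using assms by (intro tendsto_intros limits_at_bot) simp
  then show "((\<lambda>t. (U t - Y t, Q t / \<sigma>\<^sup>2, Y t)) \<longlongrightarrow> s\<^sub>1) at_bot" by (simp add: s\<^sub>1_def)
  have "((\<lambda>t. (U t - Y t, Q t / \<sigma>\<^sup>2, Y t)) \<longlongrightarrow> (1 - 3, 0 / \<sigma>\<^sup>2, 3)) at_top"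
    using assms by (intro tendsto_intros limits_at_top) simp
  then show "((\<lambda>t. (U t - Y t, Q t / \<sigma>\<^sup>2, Y t)) \<longlongrightarrow> s\<^sub>2) at_top" by (simp add: s\<^sub>2_def)
qed

end

theorem theorem1:
  fixes \<sigma>\<^sub>1 r :: real
  assumes "\<sigma>\<^sub>1 > 0" and "0 < r" and "r \<le> r_c"
  shows "\<exists>x p y :: real \<Rightarrow> real.
    heteroclinic_connection (vfield \<sigma>\<^sub>1 r) s\<^sub>1 s\<^sub>2 (\<lambda>t. (x t, p t, y t)) \<and>
    (\<exists>t\<^sub>0. x t\<^sub>0 = - (3 / 2) \<and> y t\<^sub>0 = 3 / 2)"
proof -
  obtain q w u where "trapped_orbit r q w u"
    using trapped_orbit_exists[of r] assms by (auto simp: r_c_def)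
  then interpret trapped_orbit r q w u .
  have "U 0 - Y 0 = - (3 / 2) \<and> Y 0 = 3 / 2" by (simp add: U_def Y_def)
  then have "\<exists>t\<^sub>0. U t\<^sub>0 - Y t\<^sub>0 = - (3 / 2) \<and> Y t\<^sub>0 = 3 / 2" by blast
  with reflected_heteroclinic[OF assms(1)] show ?thesis
    by (intro exI[of _ "\<lambda>t. U t - Y t"] exI[of _ "\<lambda>t. Q t / \<sigma>\<^sub>1\<^sup>2"] exI[of _ Y] conjI)
qed

end
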